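(* Let a system of ordinary differential equations of the following form be given: $$\frac{dx}{dt} = f(x,y) = p_1x^2 + q_1xy + r_1y^2,\qquad \frac{dy}{dt} = g(x,y) = p_2x^2 + q_2xy + r_2y^2,$$ where $p_i, q_i, r_i$ $(i=1,2)$ are real constants. If the coefficients satisfy the condition $$q_1^2 - 2(p_2 - r_2)q_1 - 4p_2r_2 + q_2^2 + 2(p_1 - r_1)q_2 - 4p_1r_1 = 0,$$ then there exists a strictly orthogonal Helmholtz--Hodge decomposition of the vector field $\mathbf{F}(x,y) = (f(x,y), g(x,y))^T$ on $\mathbb{R}^2$.
   Context: A Helmholtz--Hodge decomposition (HHD) of a vector field $\mathbf{F}$ on a domain $\Omega\subset\mathbb{R}^n$ is a decomposition $\mathbf{F} = -\nabla V + \mathbf{u}$, where $V:\Omega\to\mathbb{R}$ is a $C^3$ function and $\mathbf{u}$ is a vector field on $\Omega$ with $\nabla\cdot\mathbf{u} = 0$. The HHD is strictly orthogonal on $\Omega$ if $\mathbf{u}(\mathbf{x})\cdot\nabla V(\mathbf{x}) = 0$ for all $\mathbf{x}\in\Omega$. Here $\Omega = \mathbb{R}^2$. *)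

theory Defs
  imports "HOL-Analysis.Analysis"
begin

text \<open>The set \<open>\<Omega>\<close> is meant to be open throughout, so that all derivatives are two-sided.\<close>

primrec Ck_on :: "nat \<Rightarrow> 'a::real_normed_vector set \<Rightarrow> ('a \<Rightarrow> 'b::real_normed_vector) \<Rightarrow> bool"
  where
    "Ck_on 0 \<Omega> f \<longleftrightarrow> continuous_on \<Omega> f"
  | "Ck_on (Suc k) \<Omega> f \<longleftrightarrow>
       (\<forall>x\<in>\<Omega>. f differentiable (at x)) \<and>
       (\<forall>v. Ck_on k \<Omega> (\<lambda>x. frechet_derivative f (at x) v))"

text \<open>
  The value \<open>frechet_derivative f (at x) (axis i 1)\<close> is the \<open>i\<close>-th partial derivative of \<open>f\<close>
  only where \<open>f\<close> is differentiable; elsewhere the two operators below are unspecified.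
\<close>

definition grad :: "(real ^ 'n \<Rightarrow> real) \<Rightarrow> real ^ 'n \<Rightarrow> real ^ 'n"
  where "grad V x = (\<chi> i. frechet_derivative V (at x) (axis i 1))"

definition divergence :: "(real ^ 'n \<Rightarrow> real ^ 'n) \<Rightarrow> real ^ 'n \<Rightarrow> real"
  where "divergence u x = (\<Sum>i\<in>UNIV. frechet_derivative u (at x) (axis i 1) $ i)"

text \<open>Differentiability of \<open>u\<close> is demanded explicitly so that its divergence is meaningful.\<close>

definition helmholtz_hodge ::
  "(real ^ 'n) set \<Rightarrow> (real ^ 'n \<Rightarrow> real ^ 'n) \<Rightarrow> (real ^ 'n \<Rightarrow> real) \<Rightarrow> (real ^ 'n \<Rightarrow> real ^ 'n) \<Rightarrow> bool"
  where
    "helmholtz_hodge \<Omega> F V u \<longleftrightarrow>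
       Ck_on 3 \<Omega> V \<and>
       (\<forall>x\<in>\<Omega>. u differentiable (at x)) \<and>
       (\<forall>x\<in>\<Omega>. divergence u x = 0) \<and>
       (\<forall>x\<in>\<Omega>. F x = - grad V x + u x)"

definition strictly_orthogonal ::
  "(real ^ 'n) set \<Rightarrow> (real ^ 'n \<Rightarrow> real) \<Rightarrow> (real ^ 'n \<Rightarrow> real ^ 'n) \<Rightarrow> bool"
  where "strictly_orthogonal \<Omega> V u \<longleftrightarrow> (\<forall>x\<in>\<Omega>. u x \<bullet> grad V x = 0)"

end

theory Submission
  imports Defs
begin

text \<open>
  Write \<open>J\<close> for the rotation of the plane by a right angle, \<open>J (a, b) = (- b, a)\<close>. For every
  \<open>C\<^sup>2\<close> function \<open>V\<close> and every constant \<open>k\<close>, the field \<open>k J \<nabla>V\<close> is divergence free, because mixed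
  partial derivatives commute, and it is pointwise orthogonal to \<open>\<nabla>V\<close>. Hence it suffices to write
  \<open>F = - \<nabla>V + k J \<nabla>V\<close>.

  The linear map \<open>- I + k J\<close> is invertible, so this equation determines \<open>\<nabla>V\<close> as a constant
  rotation and rescaling of \<open>F\<close>. On the plane the resulting field is a gradient iff its curl
  vanishes, and that curl is a multiple of \<open>curl F + k div F\<close>. For a homogeneous quadratic field both
  \<open>div F = (2 p\<^sub>1 + q\<^sub>2) x + (q\<^sub>1 + 2 r\<^sub>2) y\<close> and \<open>curl F = (2 p\<^sub>2 - q\<^sub>1) x + (q\<^sub>2 - 2 r\<^sub>1) y\<close> are linear
  forms, and the hypothesis on the coefficients factors as
  \<open>(q\<^sub>1 - 2 p\<^sub>2) (q\<^sub>1 + 2 r\<^sub>2) + (q\<^sub>2 + 2 p\<^sub>1) (q\<^sub>2 - 2 r\<^sub>1) = 0\<close>,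
  which says exactly that these two forms are linearly dependent. If \<open>div F = 0\<close>, then \<open>V = 0\<close> and
  \<open>u = F\<close> will do. Otherwise \<open>curl F\<close> is a multiple of \<open>div F\<close>, which supplies \<open>k\<close>, and \<open>V\<close> is a
  binary cubic form.
\<close>

section \<open>Smoothness of polynomial functions\<close>

text \<open>
  The predicate \<open>Ck_on\<close> recurses on directional derivatives, so a class of differentiable functions
  closed under them is \<open>C\<^sup>k\<close> for every \<open>k\<close>. Polynomial functions form such a class.
\<close>

lemma real_polynomial_function_frechet_derivative:
  fixes p :: "'a::real_normed_vector \<Rightarrow> real"
  assumes "real_polynomial_function p"
  shows "(\<forall>x. p differentiable (at x)) \<and>
    (\<forall>v. real_polynomial_function (\<lambda>x. frechet_derivative p (at x) v))"
  using assms
proof (induction rule: real_polynomial_function.induct)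
  case (linear f)
  have "(f has_derivative f) (at x)" for x
    using linear by (rule bounded_linear_imp_has_derivative)
  then have "frechet_derivative f (at x) = f" "f differentiable (at x)" for x
    by (metis frechet_derivative_at) (metis \<open>\<And>x. (f has_derivative f) (at x)\<close> differentiable_def)
  then show ?case by (simp add: real_polynomial_function.intros(2))
next
  case (const c)
  then show ?case by (simp add: real_polynomial_function.intros(2))
next
  case (add f g)
  then have "frechet_derivative (\<lambda>x. f x + g x) (at x) =
      (\<lambda>v. frechet_derivative f (at x) v + frechet_derivative g (at x) v)" for x
    by (intro frechet_derivative_at[symmetric] has_derivative_add)
      (auto simp: frechet_derivative_works)
  with add show ?case by auto
next
  case (mult f g)
  then have "frechet_derivative (\<lambda>x. f x * g x) (at x) =
      (\<lambda>v. f x * frechet_derivative g (at x) v + frechet_derivative f (at x) v * g x)" for x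
    by (intro frechet_derivative_at[symmetric] has_derivative_mult)
      (auto simp: frechet_derivative_works)
  with mult show ?case
    by (auto intro!: real_polynomial_function.intros(3,4))
qed

lemma Ck_on_real_polynomial_function:
  fixes p :: "'a::real_normed_vector \<Rightarrow> real"
  assumes "real_polynomial_function p"
  shows "Ck_on k \<Omega> p"
  using assms
proof (induction k arbitrary: p)
  case 0
  then have "p differentiable (at x)" for x
    using real_polynomial_function_frechet_derivative by blast
  then show ?case
    by (auto intro!: continuous_at_imp_continuous_on differentiable_imp_continuous_within)
next
  case (Suc k)
  then show ?case using real_polynomial_function_frechet_derivative by auto
qed

section \<open>Binary cubic forms and quadratic vector fields\<close>

definition cubic_form :: "real \<Rightarrow> real \<Rightarrow> real \<Rightarrow> real \<Rightarrow> real ^ 2 \<Rightarrow> real"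
  where "cubic_form a b c d z =
    a * (z $ 1) ^ 3 + b * (z $ 1)\<^sup>2 * z $ 2 + c * z $ 1 * (z $ 2)\<^sup>2 + d * (z $ 2) ^ 3"

definition quadratic_field ::
  "real \<Rightarrow> real \<Rightarrow> real \<Rightarrow> real \<Rightarrow> real \<Rightarrow> real \<Rightarrow> real ^ 2 \<Rightarrow> real ^ 2"
  where "quadratic_field p\<^sub>1 q\<^sub>1 r\<^sub>1 p\<^sub>2 q\<^sub>2 r\<^sub>2 z =
    vector [p\<^sub>1 * (z $ 1)\<^sup>2 + q\<^sub>1 * z $ 1 * z $ 2 + r\<^sub>1 * (z $ 2)\<^sup>2,
            p\<^sub>2 * (z $ 1)\<^sup>2 + q\<^sub>2 * z $ 1 * z $ 2 + r\<^sub>2 * (z $ 2)\<^sup>2]"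

lemma real_polynomial_function_cubic_form: "real_polynomial_function (cubic_form a b c d)"
proof -
  have "real_polynomial_function (\<lambda>z::real ^ 2. z $ i)" for i
    by (intro real_polynomial_function.intros(1) bounded_linear_vec_nth)
  then show ?thesis
    unfolding cubic_form_def[abs_def]
    by (intro real_polynomial_function.intros(2-4) real_polynomial_function_power)
qed

lemma grad_cubic_form:
  "grad (cubic_form a b c d) = quadratic_field (3 * a) (2 * b) c b (2 * c) (3 * d)"
proof
  fix z :: "real ^ 2"
  have "(cubic_form a b c d has_derivative
      (\<lambda>h. (3 * a * (z $ 1)\<^sup>2 + 2 * b * z $ 1 * z $ 2 + c * (z $ 2)\<^sup>2) * h $ 1 +
           (b * (z $ 1)\<^sup>2 + 2 * c * z $ 1 * z $ 2 + 3 * d * (z $ 2)\<^sup>2) * h $ 2)) (at z)"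
    unfolding cubic_form_def[abs_def]
    by (rule derivative_eq_intros refl bounded_linear_vec_nth[THEN bounded_linear.has_derivative] | simp)+
      (simp add: fun_eq_iff algebra_simps power2_eq_square)
  from frechet_derivative_at[OF this, symmetric]
  show "grad (cubic_form a b c d) z = quadratic_field (3 * a) (2 * b) c b (2 * c) (3 * d) z"
    by (simp add: grad_def quadratic_field_def vec_eq_iff forall_2 axis_def)
qed

lemma has_derivative_quadratic_field:
  "(quadratic_field p\<^sub>1 q\<^sub>1 r\<^sub>1 p\<^sub>2 q\<^sub>2 r\<^sub>2 has_derivative
    (\<lambda>h. vector [(2 * p\<^sub>1 * z $ 1 + q\<^sub>1 * z $ 2) * h $ 1 + (q\<^sub>1 * z $ 1 + 2 * r\<^sub>1 * z $ 2) * h $ 2,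
                 (2 * p\<^sub>2 * z $ 1 + q\<^sub>2 * z $ 2) * h $ 1 + (q\<^sub>2 * z $ 1 + 2 * r\<^sub>2 * z $ 2) * h $ 2]))
    (at z)"
proof -
  have component: "((\<lambda>z::real ^ 2. p * (z $ 1)\<^sup>2 + q * z $ 1 * z $ 2 + r * (z $ 2)\<^sup>2) has_derivative
      (\<lambda>h. (2 * p * z $ 1 + q * z $ 2) * h $ 1 + (q * z $ 1 + 2 * r * z $ 2) * h $ 2)) (at z)"
    for p q r
    by (rule derivative_eq_intros refl bounded_linear_vec_nth[THEN bounded_linear.has_derivative] | simp)+
      (simp add: fun_eq_iff algebra_simps)
  have basis: "i = axis 1 1 \<or> i = axis 2 1" if "i \<in> Basis" for i :: "real ^ 2"
    using that exhaust_2 by (auto simp: Basis_vec_def) metis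
  show ?thesis
    unfolding quadratic_field_def[abs_def]
    by (subst has_derivative_componentwise_within)
      (auto dest!: basis simp: inner_axis component)
qed

lemma divergence_quadratic_field:
  "divergence (quadratic_field p\<^sub>1 q\<^sub>1 r\<^sub>1 p\<^sub>2 q\<^sub>2 r\<^sub>2) z =
    (2 * p\<^sub>1 + q\<^sub>2) * z $ 1 + (q\<^sub>1 + 2 * r\<^sub>2) * z $ 2"
  using frechet_derivative_at[OF has_derivative_quadratic_field, symmetric]
  by (simp add: divergence_def sum_2 axis_def algebra_simps)

section \<open>Strictly orthogonal decompositions\<close>

text \<open>
  The solenoidal part is \<open>k J \<nabla>V\<close>: with \<open>\<nabla>V = (V\<^sub>x, V\<^sub>y)\<close>, the coefficients below are those of
  \<open>(- V\<^sub>x - k V\<^sub>y, - V\<^sub>y + k V\<^sub>x)\<close>, and the matching \<open>u\<close> is \<open>(- k V\<^sub>y, k V\<^sub>x)\<close>.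
\<close>

lemma strictly_orthogonal_decomposition_of_rotated_gradient:
  fixes a b c d k :: real
  defines "V \<equiv> cubic_form a b c d"
    and "u \<equiv> quadratic_field (- k * b) (- 2 * k * c) (- 3 * k * d) (3 * k * a) (2 * k * b) (k * c)"
  shows "helmholtz_hodge UNIV
      (quadratic_field
        (- 3 * a - k * b) (- 2 * b - 2 * k * c) (- c - 3 * k * d)
        (- b + 3 * k * a) (- 2 * c + 2 * k * b) (- 3 * d + k * c)) V u"
    and "strictly_orthogonal UNIV V u"
proof -
  have "u differentiable (at z)" for z
    unfolding u_def differentiable_def using has_derivative_quadratic_field by blast
  moreover have "Ck_on 3 UNIV V"
    unfolding V_def by (intro Ck_on_real_polynomial_function real_polynomial_function_cubic_form)
  moreover have "divergence u z = 0" for z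
    unfolding u_def divergence_quadratic_field by simp
  ultimately show "helmholtz_hodge UNIV
      (quadratic_field
        (- 3 * a - k * b) (- 2 * b - 2 * k * c) (- c - 3 * k * d)
        (- b + 3 * k * a) (- 2 * c + 2 * k * b) (- 3 * d + k * c)) V u"
    unfolding helmholtz_hodge_def V_def grad_cubic_form
    by (simp add: u_def quadratic_field_def vec_eq_iff forall_2 algebra_simps)
  show "strictly_orthogonal UNIV V u"
    unfolding strictly_orthogonal_def V_def grad_cubic_form
    by (simp add: u_def quadratic_field_def inner_vec_def sum_2 algebra_simps)
qed

text \<open>
  The hypotheses on \<open>k\<close> state \<open>curl F + k div F = 0\<close>, the integrability condition for solving
  \<open>F = - \<nabla>V + k J \<nabla>V\<close> for \<open>V\<close>. Inverting \<open>- I + k J\<close> gives \<open>V\<^sub>x = s (k g - f)\<close> and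
  \<open>V\<^sub>y = - s (g + k f)\<close> with \<open>s = 1 / (1 + k\<^sup>2)\<close>, from which the cubic form is read off.
\<close>

lemma strictly_orthogonal_decomposition_if_curl_proportional_to_divergence:
  assumes curl_x: "2 * p\<^sub>2 - q\<^sub>1 = - k * (2 * p\<^sub>1 + q\<^sub>2)"
    and curl_y: "q\<^sub>2 - 2 * r\<^sub>1 = - k * (q\<^sub>1 + 2 * r\<^sub>2)"
  shows "\<exists>V u. helmholtz_hodge UNIV (quadratic_field p\<^sub>1 q\<^sub>1 r\<^sub>1 p\<^sub>2 q\<^sub>2 r\<^sub>2) V u \<and>
    strictly_orthogonal UNIV V u"
proof -
  define s where "s = 1 / (1 + k\<^sup>2)"
  define a where "a = s * (k * p\<^sub>2 - p\<^sub>1) / 3"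
  define b where "b = - s * (p\<^sub>2 + k * p\<^sub>1)"
  define c where "c = s * (k * r\<^sub>2 - r\<^sub>1)"
  define d where "d = - s * (r\<^sub>2 + k * r\<^sub>1) / 3"
  have "1 + k\<^sup>2 \<noteq> 0" by (smt (verit) zero_le_power2)
  then have s: "s * (1 + k\<^sup>2) = 1" by (simp add: s_def)
  \<comment> \<open>The coefficient of \<open>x y\<close> in either partial derivative is also determined by the other one;
      the two values agree by the integrability condition.\<close>
  have b2: "2 * b = s * (k * q\<^sub>2 - q\<^sub>1)" using curl_x unfolding b_def by algebra
  have c2: "2 * c = - s * (q\<^sub>2 + k * q\<^sub>1)" using curl_y unfolding c_def by algebra
  have "- 3 * a - k * b = p\<^sub>1" "- b + 3 * k * a = p\<^sub>2"
    using s unfolding a_def b_def by (simp; algebra)+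
  moreover have "- 2 * b - 2 * k * c = q\<^sub>1" "- 2 * c + 2 * k * b = q\<^sub>2"
    using s b2 c2 by algebra+
  moreover have "- c - 3 * k * d = r\<^sub>1" "- 3 * d + k * c = r\<^sub>2"
    using s unfolding c_def d_def by (simp; algebra)+
  ultimately show ?thesis
    using strictly_orthogonal_decomposition_of_rotated_gradient[where a = a and b = b and c = c and d = d and k = k]
    by auto
qed

lemma strictly_orthogonal_decomposition_if_divergence_free:
  assumes "2 * p\<^sub>1 + q\<^sub>2 = 0" and "q\<^sub>1 + 2 * r\<^sub>2 = 0"
  shows "\<exists>V u. helmholtz_hodge UNIV (quadratic_field p\<^sub>1 q\<^sub>1 r\<^sub>1 p\<^sub>2 q\<^sub>2 r\<^sub>2) V u \<and>
    strictly_orthogonal UNIV V u"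
proof -
  let ?F = "quadratic_field p\<^sub>1 q\<^sub>1 r\<^sub>1 p\<^sub>2 q\<^sub>2 r\<^sub>2" and ?V = "cubic_form 0 0 0 0"
  have grad: "grad ?V z = 0" for z
    by (simp add: grad_cubic_form quadratic_field_def vec_eq_iff forall_2)
  have "?F differentiable (at z)" for z
    unfolding differentiable_def using has_derivative_quadratic_field by blast
  then have "helmholtz_hodge UNIV ?F ?V ?F"
    unfolding helmholtz_hodge_def divergence_quadratic_field
    by (simp add: assms grad Ck_on_real_polynomial_function real_polynomial_function_cubic_form)
  moreover have "strictly_orthogonal UNIV ?V ?F"
    by (simp add: strictly_orthogonal_def grad)
  ultimately show ?thesis by blast
qed

theorem theorem3:
  fixes p\<^sub>1 q\<^sub>1 r\<^sub>1 p\<^sub>2 q\<^sub>2 r\<^sub>2 :: real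
    and f g :: "real \<Rightarrow> real \<Rightarrow> real"
    and F :: "real ^ 2 \<Rightarrow> real ^ 2"
  assumes f: "\<And>x y. f x y = p\<^sub>1 * x\<^sup>2 + q\<^sub>1 * x * y + r\<^sub>1 * y\<^sup>2"
    and g: "\<And>x y. g x y = p\<^sub>2 * x\<^sup>2 + q\<^sub>2 * x * y + r\<^sub>2 * y\<^sup>2"
    and F: "\<And>z. F z = vector [f (z $ 1) (z $ 2), g (z $ 1) (z $ 2)]"
    and coeffs: "q\<^sub>1\<^sup>2 - 2 * (p\<^sub>2 - r\<^sub>2) * q\<^sub>1 - 4 * p\<^sub>2 * r\<^sub>2
                 + q\<^sub>2\<^sup>2 + 2 * (p\<^sub>1 - r\<^sub>1) * q\<^sub>2 - 4 * p\<^sub>1 * r\<^sub>1 = 0"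
  shows "\<exists>V u. helmholtz_hodge UNIV F V u \<and> strictly_orthogonal UNIV V u"
proof -
  have F_eq: "F = quadratic_field p\<^sub>1 q\<^sub>1 r\<^sub>1 p\<^sub>2 q\<^sub>2 r\<^sub>2"
    by (simp add: fun_eq_iff F f g quadratic_field_def)
  \<comment> \<open>Linear dependence of \<open>div F\<close> and \<open>curl F\<close>.\<close>
  have dependent: "(2 * p\<^sub>2 - q\<^sub>1) * (q\<^sub>1 + 2 * r\<^sub>2) = (q\<^sub>2 - 2 * r\<^sub>1) * (2 * p\<^sub>1 + q\<^sub>2)"
    using coeffs by algebra
  consider (div_free) "2 * p\<^sub>1 + q\<^sub>2 = 0" "q\<^sub>1 + 2 * r\<^sub>2 = 0"
    | (div_x) "2 * p\<^sub>1 + q\<^sub>2 \<noteq> 0" | (div_y) "q\<^sub>1 + 2 * r\<^sub>2 \<noteq> 0"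
    by blast
  then show ?thesis
  proof cases
    case div_free
    then show ?thesis
      unfolding F_eq by (rule strictly_orthogonal_decomposition_if_divergence_free)
  next
    case div_x
    with dependent show ?thesis
      unfolding F_eq
      by (intro strictly_orthogonal_decomposition_if_curl_proportional_to_divergence
          [where k = "- (2 * p\<^sub>2 - q\<^sub>1) / (2 * p\<^sub>1 + q\<^sub>2)"]) (simp_all add: field_simps)
  next
    case div_y
    with dependent show ?thesis
      unfolding F_eq
      by (intro strictly_orthogonal_decomposition_if_curl_proportional_to_divergence
          [where k = "- (q\<^sub>2 - 2 * r\<^sub>1) / (q\<^sub>1 + 2 * r\<^sub>2)"]) (simp_all add: field_simps)
  qed
qed

end
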